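(* Let $\mathscr{A}$ be a $C^*$-algebra, let $S$ be a non-empty set, let $K: S\times S \to \mathscr{A}$ be a hermitian kernel and let $s_0\in S$. Then $K$ is conditionally positive definite if and only if the kernel $L: S\times S \to \mathscr{A}$ defined by $$L(s,t):=\frac{1}{2}\left[K(s,t)-K(s,s_0)-K(s_0,t)+K(s_0,s_0)\right]$$ is a positive definite kernel.
   Context: A kernel is a map $S\times S\to\mathscr{A}$. A kernel $L$ is hermitian if $L(t,s)^*=L(s,t)$ for all $s,t\in S$. A hermitian kernel $L$ is positive definite if $\sum_{i,j=1}^n a_i^*L(s_i,s_j)a_j\geq 0$ for every positive integer $n$, all $s_1,\dots,s_n\in S$ and all $a_1,\dots,a_n\in\mathscr{A}$. A hermitian kernel $K$ is conditionally positive definite if $\sum_{i,j=1}^n a_i^*K(s_i,s_j)a_j\geq 0$ for all integers $n\geq 2$, all $s_1,\dots,s_n\in S$ and all $a_1,\dots,a_n\in\mathscr{A}$ with $\sum_{i=1}^n a_i=0$. Here $\geq 0$ means being a positive element of $\mathscr{A}$. *)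

theory Defs
  imports Complex_Main
begin

text \<open>
  A C*-algebra, not assumed to have a unit. The distribution has no complex algebras, so the
  complex scalar multiplication is added on top of the real one and required to extend it;
  unitality of the scalar action and submultiplicativity of the norm are inherited from
  \<^class>\<open>real_normed_algebra\<close>, completeness from \<^class>\<open>banach\<close>.
\<close>

class cstar_algebra = real_normed_algebra + banach +
  fixes scaleC :: "complex \<Rightarrow> 'a \<Rightarrow> 'a"  (infixr "*\<^sub>C" 75)
    and star :: "'a \<Rightarrow> 'a"
  assumes scaleC_add_right: "c *\<^sub>C (x + y) = c *\<^sub>C x + c *\<^sub>C y"
    and scaleC_add_left: "(c + d) *\<^sub>C x = c *\<^sub>C x + d *\<^sub>C x"
    and scaleC_scaleC: "c *\<^sub>C d *\<^sub>C x = (c * d) *\<^sub>C x"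
    and scaleR_scaleC: "r *\<^sub>R x = complex_of_real r *\<^sub>C x"
    and mult_scaleC_left: "(c *\<^sub>C x) * y = c *\<^sub>C (x * y)"
    and mult_scaleC_right: "x * (c *\<^sub>C y) = c *\<^sub>C (x * y)"
    and norm_scaleC: "norm (c *\<^sub>C x) = cmod c * norm x"
    and star_add: "star (x + y) = star x + star y"
    and star_scaleC: "star (c *\<^sub>C x) = cnj c *\<^sub>C star x"
    and star_mult: "star (x * y) = star y * star x"
    and star_star: "star (star x) = x"
    and cstar_identity: "norm (star x * x) = (norm x)\<^sup>2"

instantiation complex :: cstar_algebra
begin

definition scaleC_complex :: "complex \<Rightarrow> complex \<Rightarrow> complex"
  where "scaleC_complex c z = c * z"

definition star_complex :: "complex \<Rightarrow> complex"
  where "star_complex z = cnj z"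

instance
  by standard
    (auto simp: scaleC_complex_def star_complex_def algebra_simps norm_mult scaleR_conv_of_real
      power2_eq_square)

end

definition is_identity :: "'a::cstar_algebra \<Rightarrow> bool"
  where "is_identity e \<longleftrightarrow> (\<forall>x. e * x = x \<and> x * e = x)"

text \<open>
  Multiplication of the unitization \<open>A \<oplus> \<complex>\<close>, where \<open>(a, \<alpha>)\<close> stands for \<open>a + \<alpha> 1\<close>;
  its identity is \<open>(0, 1)\<close>.
\<close>

definition unitization_mult ::
    "'a::cstar_algebra \<times> complex \<Rightarrow> 'a \<times> complex \<Rightarrow> 'a \<times> complex"
  where "unitization_mult u v =
    (fst u * fst v + snd u *\<^sub>C fst v + snd v *\<^sub>C fst u, snd u * snd v)"

text \<open>
  The spectrum is taken in the algebra itself if it has an identity, and in the unitization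
  otherwise; there \<open>a - z 1\<close> is the pair \<open>(a, - z)\<close>.
\<close>

definition spectrum :: "'a::cstar_algebra \<Rightarrow> complex set"
  where "spectrum a =
    (if \<exists>e::'a. is_identity e
     then {z. \<not> (\<exists>e b. is_identity e \<and> (a - z *\<^sub>C e) * b = e \<and> b * (a - z *\<^sub>C e) = e)}
     else {z. \<not> (\<exists>v. unitization_mult (a, - z) v = (0, 1) \<and> unitization_mult v (a, - z) = (0, 1))})"

definition positive_element :: "'a::cstar_algebra \<Rightarrow> bool"
  where "positive_element a \<longleftrightarrow> star a = a \<and> spectrum a \<subseteq> complex_of_real ` {0..}"

text \<open>
  A kernel on \<open>S\<close> is a curried function of which only the values on \<open>S \<times> S\<close> matter.
  As in the usual terminology, a (conditionally) positive definite kernel is in particular hermitian.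
\<close>

definition hermitian_kernel :: "'s set \<Rightarrow> ('s \<Rightarrow> 's \<Rightarrow> 'a::cstar_algebra) \<Rightarrow> bool"
  where "hermitian_kernel S L \<longleftrightarrow> (\<forall>s\<in>S. \<forall>t\<in>S. star (L t s) = L s t)"

definition positive_definite_kernel :: "'s set \<Rightarrow> ('s \<Rightarrow> 's \<Rightarrow> 'a::cstar_algebra) \<Rightarrow> bool"
  where "positive_definite_kernel S L \<longleftrightarrow>
    hermitian_kernel S L \<and>
    (\<forall>n\<ge>1. \<forall>s :: nat \<Rightarrow> 's. \<forall>a :: nat \<Rightarrow> 'a. (\<forall>i\<in>{1..n}. s i \<in> S) \<longrightarrow>
      positive_element (\<Sum>i=1..n. \<Sum>j=1..n. star (a i) * L (s i) (s j) * a j))"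

definition conditionally_positive_definite_kernel ::
    "'s set \<Rightarrow> ('s \<Rightarrow> 's \<Rightarrow> 'a::cstar_algebra) \<Rightarrow> bool"
  where "conditionally_positive_definite_kernel S K \<longleftrightarrow>
    hermitian_kernel S K \<and>
    (\<forall>n\<ge>2. \<forall>s :: nat \<Rightarrow> 's. \<forall>a :: nat \<Rightarrow> 'a.
      (\<forall>i\<in>{1..n}. s i \<in> S) \<longrightarrow> (\<Sum>i=1..n. a i) = 0 \<longrightarrow>
      positive_element (\<Sum>i=1..n. \<Sum>j=1..n. star (a i) * K (s i) (s j) * a j))"

end

theory Submission
  imports Defs
begin

text \<open>
  Write \<open>M s t = K s t - K s s0 - K s0 t + K s0 s0\<close>, so that \<open>L\<close> is half of \<open>M\<close>. Two facts about
  \<open>M\<close> carry the proof. The three terms by which \<open>M\<close> differs from \<open>K\<close> depend on at most one of \<open>s\<close>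
  and \<open>t\<close>, so they contribute nothing to \<open>\<Sum>i j. a\<^sub>i\<^sup>* M(s\<^sub>i,s\<^sub>j) a\<^sub>j\<close> once the coefficients \<open>a\<^sub>i\<close> sum
  to zero (\<open>centred_form_eq\<close>); this gives the implication from \<open>L\<close> to \<open>K\<close>. Moreover
  \<open>M\<close> vanishes when one of its arguments is \<open>s0\<close>, so any family \<open>(s\<^sub>i, a\<^sub>i)\<close> may be completed by the
  pair \<open>(s0, - \<Sum>i. a\<^sub>i)\<close>: the coefficients then sum to zero while the form of \<open>M\<close> keeps its value
  (\<open>balanced_extension_form\<close>). This gives the converse.

  The factor \<open>1/2\<close> is harmless because positive elements are invariant under positive real scaling
  (\<open>positive_element_scaleR_iff\<close>), which in turn comes from the scaling of the spectrum
  (\<open>spectrum_scaleC_subset\<close>).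
\<close>

section \<open>The involution and scalar multiplication\<close>

lemma star_zero: "star (0::'a::cstar_algebra) = 0"
  using star_add[of "0::'a" 0] by simp

lemma star_minus: "star (- x) = - star (x::'a::cstar_algebra)"
  using star_add[of x "- x"] by (simp add: star_zero eq_neg_iff_add_eq_0 add.commute)

lemma star_diff: "star (x - y) = star x - star (y::'a::cstar_algebra)"
  using star_add[of x "- y"] by (simp add: star_minus)

lemma star_scaleR: "star (r *\<^sub>R x) = r *\<^sub>R star (x::'a::cstar_algebra)"
  by (simp add: scaleR_scaleC star_scaleC)

lemma star_sum: "star (sum f I) = (\<Sum>i\<in>I. star (f i :: 'a::cstar_algebra))"
  by (induction I rule: infinite_finite_induct) (simp_all add: star_zero star_add)

lemma scaleC_one: "1 *\<^sub>C x = (x::'a::cstar_algebra)"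
  using scaleR_scaleC[of 1 x] by simp

lemma scaleC_diff_right: "c *\<^sub>C (x - y) = c *\<^sub>C x - c *\<^sub>C (y::'a::cstar_algebra)"
  using scaleC_add_right[of c "x - y" y] by simp

section \<open>Scaling the spectrum and positive elements\<close>

text \<open>An inverse of \<open>c a - c z\<close> is an inverse of \<open>a - z\<close> divided by \<open>c\<close>, and this holds in the
  algebra as well as in its unitization.\<close>

lemma spectrum_scaleC_subset:
  fixes a :: "'a::cstar_algebra"
  assumes "c \<noteq> 0"
  shows "spectrum (c *\<^sub>C a) \<subseteq> (\<lambda>z. c * z) ` spectrum a"
proof
  fix w assume w: "w \<in> spectrum (c *\<^sub>C a)"
  define z where "z = w / c"
  have wz: "w = c * z" using assms by (simp add: z_def)
  have "z \<in> spectrum a"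
  proof (rule ccontr)
    assume z: "z \<notin> spectrum a"
    show False
    proof (cases "\<exists>e::'a. is_identity e")
      case True
      with z obtain e b :: 'a where e: "is_identity e"
        and b: "(a - z *\<^sub>C e) * b = e" "b * (a - z *\<^sub>C e) = e"
        by (auto simp: spectrum_def)
      have "c *\<^sub>C a - w *\<^sub>C e = c *\<^sub>C (a - z *\<^sub>C e)"
        by (simp add: wz scaleC_diff_right scaleC_scaleC)
      then have "(c *\<^sub>C a - w *\<^sub>C e) * ((1 / c) *\<^sub>C b) = e"
        and "((1 / c) *\<^sub>C b) * (c *\<^sub>C a - w *\<^sub>C e) = e"
        using b assms
        by (simp_all add: mult_scaleC_left mult_scaleC_right scaleC_scaleC scaleC_one)
      with e True w show False by (auto simp: spectrum_def)
    next
      case False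
      with z obtain v where v: "unitization_mult (a, - z) v = (0, 1)"
        "unitization_mult v (a, - z) = (0, 1)"
        by (auto simp: spectrum_def)
      define v' where "v' = ((1 / c) *\<^sub>C fst v, snd v / c)"
      have "unitization_mult (c *\<^sub>C a, - w) v' = unitization_mult (a, - z) v"
        and "unitization_mult v' (c *\<^sub>C a, - w) = unitization_mult v (a, - z)"
        using assms
        by (simp_all add: unitization_mult_def v'_def wz mult_scaleC_left mult_scaleC_right
            scaleC_scaleC scaleC_one)
      with v False w show False
        by (auto simp: spectrum_def simp del: split_paired_All split_paired_Ex)
    qed
  qed
  with wz show "w \<in> (\<lambda>z. c * z) ` spectrum a" by blast
qed

lemma positive_element_scaleR:
  fixes a :: "'a::cstar_algebra"
  assumes "positive_element a" and "r > 0"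
  shows "positive_element (r *\<^sub>R a)"
proof -
  have "spectrum (r *\<^sub>R a) \<subseteq> (\<lambda>z. complex_of_real r * z) ` spectrum a"
    using spectrum_scaleC_subset[of "complex_of_real r" a] assms(2) by (simp add: scaleR_scaleC)
  also have "\<dots> \<subseteq> (\<lambda>z. complex_of_real r * z) ` complex_of_real ` {0..}"
    using assms(1) by (intro image_mono) (simp add: positive_element_def)
  also have "\<dots> \<subseteq> complex_of_real ` {0..}"
    using assms(2) by (auto simp flip: of_real_mult)
  finally show ?thesis
    using assms(1) by (simp add: positive_element_def star_scaleR)
qed

lemma positive_element_scaleR_iff:
  fixes a :: "'a::cstar_algebra"
  assumes "r > 0"
  shows "positive_element (r *\<^sub>R a) \<longleftrightarrow> positive_element a"
  using positive_element_scaleR[of a r] positive_element_scaleR[of "r *\<^sub>R a" "1 / r"] assms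
  by auto

section \<open>Centring a kernel at a base point\<close>

definition centred_kernel :: "('s \<Rightarrow> 's \<Rightarrow> 'a::ab_group_add) \<Rightarrow> 's \<Rightarrow> 's \<Rightarrow> 's \<Rightarrow> 'a"
  where "centred_kernel K s0 s t = K s t - K s s0 - K s0 t + K s0 s0"

lemma centred_kernel_base:
  "centred_kernel K s0 s s0 = 0" "centred_kernel K s0 s0 t = 0"
  by (simp_all add: centred_kernel_def)

lemma hermitian_half_centred_kernel:
  assumes "hermitian_kernel S K" and "s0 \<in> S"
  shows "hermitian_kernel S (\<lambda>s t. (1/2) *\<^sub>R centred_kernel K s0 s t)"
  using assms
  by (simp add: hermitian_kernel_def centred_kernel_def star_scaleR star_add star_diff)

text \<open>Each correction term is constant in the first or in the second argument of the kernel, so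
  summing over the corresponding index produces the factor \<open>\<Sum>i. a\<^sub>i\<close> or its adjoint.\<close>

lemma centred_form_eq:
  fixes a :: "'i \<Rightarrow> 'a::cstar_algebra"
  assumes "sum a I = 0"
  shows "(\<Sum>i\<in>I. \<Sum>j\<in>I. star (a i) * centred_kernel K s0 (s i) (s j) * a j) =
    (\<Sum>i\<in>I. \<Sum>j\<in>I. star (a i) * K (s i) (s j) * a j)"
proof -
  have right: "(\<Sum>i\<in>I. \<Sum>j\<in>I. star (a i) * f i * a j) = 0" for f
    using assms by (simp flip: sum_distrib_left)
  have "(\<Sum>i\<in>I. star (a i)) = 0"
    using assms by (simp add: star_zero flip: star_sum)
  then have left: "(\<Sum>i\<in>I. \<Sum>j\<in>I. star (a i) * g j * a j) = 0" for g
    by (subst sum.swap) (simp flip: sum_distrib_right)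
  show ?thesis
    using right[of "\<lambda>i. K (s i) s0"] right[of "\<lambda>i. K s0 s0"] left[of "\<lambda>j. K s0 (s j)"]
    by (simp add: centred_kernel_def distrib_left distrib_right left_diff_distrib
        right_diff_distrib sum.distrib sum_subtractf)
qed

text \<open>Completing the family by the base point with the balancing coefficient makes
  \<open>centred_form_eq\<close> applicable; it costs nothing because the centred kernel vanishes at the
  base point.\<close>

lemma balanced_extension_form:
  fixes a :: "nat \<Rightarrow> 'a::cstar_algebra" and n :: nat
  defines "b \<equiv> a(Suc n := - (\<Sum>i=1..n. a i))"
  shows "(\<Sum>i=1..Suc n. b i) = 0"
    and "(\<Sum>i=1..Suc n. \<Sum>j=1..Suc n.
        star (b i) * K ((s(Suc n := s0)) i) ((s(Suc n := s0)) j) * b j) =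
      (\<Sum>i=1..n. \<Sum>j=1..n. star (a i) * centred_kernel K s0 (s i) (s j) * a j)"
proof -
  show sum_b: "(\<Sum>i=1..Suc n. b i) = 0"
    by (simp add: b_def)
  show "(\<Sum>i=1..Suc n. \<Sum>j=1..Suc n.
        star (b i) * K ((s(Suc n := s0)) i) ((s(Suc n := s0)) j) * b j) =
      (\<Sum>i=1..n. \<Sum>j=1..n. star (a i) * centred_kernel K s0 (s i) (s j) * a j)"
    unfolding centred_form_eq[OF sum_b, of K s0, symmetric]
    by (simp add: b_def centred_kernel_base)
qed

section \<open>The equivalence\<close>

theorem theorem2p4:
  fixes S :: "'s set"
    and K :: "'s \<Rightarrow> 's \<Rightarrow> 'a::cstar_algebra"
    and s0 :: 's
  assumes "S \<noteq> {}"
    and "hermitian_kernel S K"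
    and "s0 \<in> S"
  shows "conditionally_positive_definite_kernel S K \<longleftrightarrow>
    positive_definite_kernel S (\<lambda>s t. (1/2) *\<^sub>R (K s t - K s s0 - K s0 t + K s0 s0))"
proof -
  let ?L = "\<lambda>s t. (1/2) *\<^sub>R centred_kernel K s0 s t"
  have L_positive_iff:
    "positive_element (\<Sum>i=1..n. \<Sum>j=1..n. star (a i) * ?L (s i) (s j) * a j) \<longleftrightarrow>
     positive_element (\<Sum>i=1..n. \<Sum>j=1..n. star (a i) * centred_kernel K s0 (s i) (s j) * a j)"
    for n :: nat and s a
    using positive_element_scaleR_iff[of "1/2"
        "\<Sum>i=1..n. \<Sum>j=1..n. star (a i) * centred_kernel K s0 (s i) (s j) * a j"]
    by (simp add: scaleR_sum_right)
  have "conditionally_positive_definite_kernel S K \<longleftrightarrow> positive_definite_kernel S ?L"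
  proof
    assume K: "conditionally_positive_definite_kernel S K"
    have "positive_element (\<Sum>i=1..n. \<Sum>j=1..n. star (a i) * ?L (s i) (s j) * a j)"
      if n: "n \<ge> 1" and s: "\<forall>i\<in>{1..n}. s i \<in> S" for n s and a :: "nat \<Rightarrow> 'a"
    proof -
      let ?b = "a(Suc n := - (\<Sum>i=1..n. a i))" and ?s = "s(Suc n := s0)"
      have "Suc n \<ge> 2" and "\<forall>i\<in>{1..Suc n}. ?s i \<in> S"
        using n s assms(3) by auto
      then have "positive_element
          (\<Sum>i=1..Suc n. \<Sum>j=1..Suc n. star (?b i) * K (?s i) (?s j) * ?b j)"
        using K balanced_extension_form(1)[of a n]
        unfolding conditionally_positive_definite_kernel_def by blast
      then show ?thesis
        unfolding L_positive_iff balanced_extension_form(2) .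
    qed
    then show "positive_definite_kernel S ?L"
      unfolding positive_definite_kernel_def
      using hermitian_half_centred_kernel[OF assms(2,3)] by blast
  next
    assume L: "positive_definite_kernel S ?L"
    have "positive_element (\<Sum>i=1..n. \<Sum>j=1..n. star (a i) * K (s i) (s j) * a j)"
      if n: "n \<ge> 2" and s: "\<forall>i\<in>{1..n}. s i \<in> S" and a: "(\<Sum>i=1..n. a i) = 0"
      for n s and a :: "nat \<Rightarrow> 'a"
    proof -
      have "n \<ge> 1" using n by simp
      with L s have "positive_element (\<Sum>i=1..n. \<Sum>j=1..n. star (a i) * ?L (s i) (s j) * a j)"
        unfolding positive_definite_kernel_def by blast
      then show ?thesis
        unfolding L_positive_iff centred_form_eq[OF a] .
    qed
    then show "conditionally_positive_definite_kernel S K"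
      unfolding conditionally_positive_definite_kernel_def using assms(2) by blast
  qed
  then show ?thesis by (simp only: centred_kernel_def)
qed

end
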